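(* Let $\alpha>0$, $\alpha\neq 1$. For every discrete random variable $X$ with finite support, the Tsallis extropy satisfies $JS_\alpha(X)<1$.
   Context: $X$ is a discrete random variable with support $S=\{x_1,\dots,x_N\}$ and probability vector $\mathbf p=(p_1,\dots,p_N)$, $p_i=\mathbb P(X=x_i)\ge 0$, $\sum_{i=1}^N p_i=1$ (zero entries are allowed, e.g. the vector $(1,0,\dots,0)$ is admitted). For $\alpha>0$, $\alpha\neq1$, the Tsallis extropy of $X$ is $$JS_\alpha(X)=\frac{1}{\alpha-1}\left(N-1-\sum_{i=1}^N(1-p_i)^\alpha\right).$$ *)

theory Defs
  imports "HOL-Probability.Probability"
begin

text \<open>
  \<open>X\<close> is a random variable with finite support \<open>S = {x\<^sub>1, \<dots>, x\<^sub>N}\<close>. Points of \<open>S\<close> may carry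
  probability \<open>0\<close>, and \<open>X\<close> only has to take its values in \<open>S\<close> almost surely; no structure is imposed on
  the type of values (for real-valued, Borel-measurable \<open>X\<close> the measurability clause is automatic).
\<close>

definition finite_support_rv :: "'a measure \<Rightarrow> ('a \<Rightarrow> 'b) \<Rightarrow> 'b set \<Rightarrow> bool" where
  "finite_support_rv M X S \<longleftrightarrow>
     prob_space M \<and> finite S \<and>
     (\<forall>x\<in>S. {\<omega> \<in> space M. X \<omega> = x} \<in> sets M) \<and>
     (\<Sum>x\<in>S. measure M {\<omega> \<in> space M. X \<omega> = x}) = 1"

definition tsallis_extropy :: "real \<Rightarrow> 'a measure \<Rightarrow> ('a \<Rightarrow> 'b) \<Rightarrow> 'b set \<Rightarrow> real" where
  "tsallis_extropy \<alpha> M X S =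
     1 / (\<alpha> - 1) *
       (real (card S) - 1 - (\<Sum>x\<in>S. (1 - measure M {\<omega> \<in> space M. X \<omega> = x}) powr \<alpha>))"

end

theory Submission
  imports Defs
begin

text \<open>
  Put \<open>q\<^sub>i = 1 - p\<^sub>i\<close>. Since the \<open>p\<^sub>i\<close> sum to \<open>1\<close>, the \<open>q\<^sub>i\<close> sum to \<open>N - 1\<close>, so the extropy splits into
  a sum of one-point terms \<open>(q\<^sub>i - q\<^sub>i powr \<alpha>) / (\<alpha> - 1)\<close>. Bernoulli's inequality compares
  \<open>q powr \<alpha>\<close> with its tangent line \<open>1 - \<alpha> (1 - q)\<close> at \<open>q = 1\<close>: the power lies above the line for
  \<open>\<alpha> > 1\<close> and below it for \<open>\<alpha> < 1\<close>. The sign of \<open>\<alpha> - 1\<close> changes at the same place, so in both cases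
  the inequality says that the one-point term is at most \<open>1 - q\<^sub>i = p\<^sub>i\<close>, strictly unless \<open>p\<^sub>i = 0\<close>.
  The sum is therefore at most \<open>1\<close>, and strictly less because some \<open>p\<^sub>i\<close> is positive.
\<close>

text \<open>
  After clearing the denominator this is the strict Bernoulli inequality. For \<open>q > 0\<close> the mean value
  theorem gives \<open>1 - q powr \<alpha> = (1 - q) \<alpha> z powr (\<alpha> - 1)\<close> with \<open>z < 1\<close>, and \<open>z powr (\<alpha> - 1)\<close> lies
  below or above \<open>1\<close> according to the sign of \<open>\<alpha> - 1\<close>. The point \<open>q = 0\<close> is treated apart because
  the power need not be differentiable there; its term is \<open>0\<close>.
\<close>

lemma tsallis_term_less:
  fixes \<alpha> q :: real
  assumes "\<alpha> > 0" "\<alpha> \<noteq> 1" "0 \<le> q" "q < 1"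
  shows "(q - q powr \<alpha>) / (\<alpha> - 1) < 1 - q"
proof (cases "q = 0")
  case True
  then show ?thesis by simp
next
  case False
  then have q: "0 < q" using assms by simp
  have "\<exists>z. q < z \<and> z < 1 \<and>
      1 powr \<alpha> - q powr \<alpha> = (1 - q) * (\<alpha> * z powr (\<alpha> - 1))"
    using q by (intro MVT2 assms) (auto intro!: derivative_eq_intros)
  then obtain z where z: "q < z" "z < 1"
    and eq: "1 - q powr \<alpha> = \<alpha> * (1 - q) * z powr (\<alpha> - 1)"
    by (auto simp: mult_ac)
  have pos: "0 < \<alpha> * (1 - q)" using assms by simp
  show ?thesis
  proof (cases "\<alpha> > 1")
    case True
    have "z powr (\<alpha> - 1) < 1 powr (\<alpha> - 1)"
      using True z q by (intro powr_less_mono2) auto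
    then have "1 - q powr \<alpha> < \<alpha> * (1 - q)"
      unfolding eq using mult_strict_left_mono[OF _ pos] by fastforce
    then have "q - q powr \<alpha> < (1 - q) * (\<alpha> - 1)"
      by (simp add: algebra_simps)
    then show ?thesis using True by (simp add: pos_divide_less_eq)
  next
    case False
    then have "\<alpha> < 1" using assms by simp
    have "1 powr (\<alpha> - 1) < z powr (\<alpha> - 1)"
      using \<open>\<alpha> < 1\<close> z q by (intro powr_less_mono2_neg) auto
    then have "\<alpha> * (1 - q) < 1 - q powr \<alpha>"
      unfolding eq using mult_strict_left_mono[OF _ pos] by fastforce
    then have "(1 - q) * (\<alpha> - 1) < q - q powr \<alpha>"
      by (simp add: algebra_simps)
    then show ?thesis using \<open>\<alpha> < 1\<close> by (simp add: neg_divide_less_eq)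
  qed
qed

theorem theorem3p2:
  fixes \<alpha> :: real and M :: "'a measure" and X :: "'a \<Rightarrow> 'b" and S :: "'b set"
  assumes "\<alpha> > 0" and "\<alpha> \<noteq> 1"
    and "finite_support_rv M X S"
  shows "tsallis_extropy \<alpha> M X S < 1"
proof -
  define p where "p x = measure M {\<omega> \<in> space M. X \<omega> = x}" for x
  interpret prob_space M
    using assms(3) by (simp add: finite_support_rv_def)
  have fin: "finite S" and sum_p: "(\<Sum>x\<in>S. p x) = 1"
    using assms(3) by (simp_all add: finite_support_rv_def p_def)
  have p: "0 \<le> p x" "p x \<le> 1" for x
    by (simp_all add: p_def)
  let ?t = "\<lambda>x. ((1 - p x) - (1 - p x) powr \<alpha>) / (\<alpha> - 1)"
  have less: "?t x < p x" if "p x \<noteq> 0" for x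
    using tsallis_term_less[OF assms(1,2), of "1 - p x"] p[of x] that by simp
  have le: "?t x \<le> p x" for x
    using less[of x] by (cases "p x = 0") auto
  have "\<exists>x\<in>S. p x \<noteq> 0"
    using sum_p by (metis sum.neutral zero_neq_one)
  then have "(\<Sum>x\<in>S. ?t x) < (\<Sum>x\<in>S. p x)"
    using fin le less by (intro sum_strict_mono_ex1) auto
  moreover have "tsallis_extropy \<alpha> M X S = (\<Sum>x\<in>S. ?t x)"
  proof -
    have "real (card S) - 1 = (\<Sum>x\<in>S. 1 - p x)"
      by (simp add: sum_subtractf sum_p)
    then show ?thesis
      unfolding tsallis_extropy_def p_def[symmetric]
      by (simp add: sum_subtractf flip: sum_divide_distrib)
  qed
  ultimately show ?thesis using sum_p by simp
qed

end
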